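(* Let $n,N\in\mathbb{N}$, let $\Omega\subseteq\mathbb{R}^n$ be an open set and let $H:\Omega\times\mathbb{R}^{N\times n}\to[0,\infty)$ be a continuous function such that for every $x\in\Omega$ and every $t\ge 0$ the sublevel set $\{P\in\mathbb{R}^{N\times n}: H(x,P)\le t\}$ is a rank-one convex subset of $\mathbb{R}^{N\times n}$. Let $u\in C^1(\Omega,\mathbb{R}^N)$ satisfy $H(x,\mathrm{D}u(x))=c$ for all $x\in\Omega$, for some constant $c\ge 0$. Then for every open $\Omega'\Subset\Omega$, every $\phi\in W^{1,\infty}_0(\Omega')$, every $\xi\in\mathbb{R}^N$ and every $x\in\Omega'$ at which $\phi$ achieves a local maximum or a local minimum, $$\operatorname*{ess\,sup}_{\Omega'}H(\cdot,\mathrm{D}u)\le\lim_{\rho\to 0}\Big(\operatorname*{ess\,sup}_{\mathbb{B}_\rho(x)}H\big(\cdot,\mathrm{D}u+\xi\otimes\mathrm{D}\phi\big)\Big).$$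
   Context: A set $\mathcal{C}\subseteq\mathbb{R}^{N\times n}$ is called rank-one convex if for all $A,B\in\mathcal{C}$ with $\mathrm{rk}(A-B)\le 1$ and all $\lambda\in[0,1]$ one has $\lambda A+(1-\lambda)B\in\mathcal{C}$. $U\Subset V$ means that $U$ is open and its closure is compact and contained in $V$. $\mathbb{B}_\rho(x)$ is the open ball in $\mathbb{R}^n$ of radius $\rho>0$ centred at $x$; the limit is over $\rho\to0^+$ with $\rho$ small enough that $\mathbb{B}_\rho(x)\Subset\Omega'$. $\mathrm{D}u(y)\in\mathbb{R}^{N\times n}$ is the gradient matrix, and essential suprema are with respect to Lebesgue measure. $W^{1,\infty}_0(\Omega')$ denotes the scalar functions in $W^{1,\infty}(\Omega')$ vanishing on $\partial\Omega'$; such functions are identified with their continuous representatives, so local maxima and minima in $\Omega'$ are meant pointwise and are not required to be strict. For $\xi\in\mathbb{R}^N$ and $p\in\mathbb{R}^n$, $\xi\otimes p$ is the $N\times n$ matrix with entries $\xi_\alpha p_i$. *)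

theory Defs
  imports "HOL-Analysis.Analysis" "HOL-Probability.Essential_Supremum"
begin

(* The types 'n and 'm index the n coordinates of the domain and the N coordinates of the
   target; an element of real^'n^'m is a matrix with N rows and n columns. *)

definition rank_one_convex :: "(real^'n^'m) set \<Rightarrow> bool" where
  "rank_one_convex C \<longleftrightarrow>
     (\<forall>A\<in>C. \<forall>B\<in>C. rank (A - B) \<le> 1 \<longrightarrow>
        (\<forall>l\<in>{0..1}. l *\<^sub>R A + (1 - l) *\<^sub>R B \<in> C))"

definition tensor :: "real^'m \<Rightarrow> real^'n \<Rightarrow> real^'n^'m"  (infixr "\<otimes>\<^sub>v" 75) where
  "\<xi> \<otimes>\<^sub>v p = (\<chi> a i. \<xi> $ a * p $ i)"

definition compactly_contained :: "'a::topological_space set \<Rightarrow> 'a set \<Rightarrow> bool" where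
  "compactly_contained U V \<longleftrightarrow> open U \<and> compact (closure U) \<and> closure U \<subseteq> V"

definition partial :: "'n \<Rightarrow> (real^'n \<Rightarrow> 'b::real_normed_vector) \<Rightarrow> real^'n \<Rightarrow> 'b" where
  "partial i f x = frechet_derivative f (at x) (axis i 1)"

(* Intended for open S only: at x is the punctured neighbourhood filter of the whole space. *)
primrec Ck_on :: "nat \<Rightarrow> (real^'n) set \<Rightarrow> (real^'n \<Rightarrow> 'b::real_normed_vector) \<Rightarrow> bool" where
  "Ck_on 0 S f \<longleftrightarrow> continuous_on S f"
| "Ck_on (Suc k) S f \<longleftrightarrow>
     (\<forall>x\<in>S. f differentiable (at x)) \<and> (\<forall>i. Ck_on k S (partial i f))"

(* Elements of the space of compactly supported smooth functions on S, extended by zero. *)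
definition test_function :: "(real^'n) set \<Rightarrow> (real^'n \<Rightarrow> real) \<Rightarrow> bool" where
  "test_function S \<psi> \<longleftrightarrow> (\<forall>k. Ck_on k UNIV \<psi>) \<and>
     compact (closure {x. \<psi> x \<noteq> 0}) \<and> closure {x. \<psi> x \<noteq> 0} \<subseteq> S"

definition Linf :: "'a::euclidean_space set \<Rightarrow> ('a \<Rightarrow> 'b::euclidean_space) set" where
  "Linf S = {f. f \<in> borel_measurable (lebesgue_on S) \<and>
                (\<exists>B. AE x in lebesgue_on S. norm (f x) \<le> B)}"

(* g is a representative, of class L-infinity, of the distributional gradient of f on S. *)
definition Linf_weak_gradient ::
    "(real^'n) set \<Rightarrow> (real^'n \<Rightarrow> real) \<Rightarrow> (real^'n \<Rightarrow> real^'n) \<Rightarrow> bool" where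
  "Linf_weak_gradient S f g \<longleftrightarrow> g \<in> Linf S \<and>
     (\<forall>\<psi>. test_function S \<psi> \<longrightarrow>
        (\<forall>i. (LINT y|lebesgue_on S. f y * partial i \<psi> y)
               = - (LINT y|lebesgue_on S. g y $ i * \<psi> y)))"

definition W1inf :: "(real^'n) set \<Rightarrow> (real^'n \<Rightarrow> real) set" where
  "W1inf S = {f \<in> Linf S. \<exists>g. Linf_weak_gradient S f g}"

(* Continuous representatives, extended continuously to the closure of S. *)
definition W1inf_0 :: "(real^'n) set \<Rightarrow> (real^'n \<Rightarrow> real) set" where
  "W1inf_0 S = {f \<in> W1inf S. continuous_on (closure S) f \<and> (\<forall>x\<in>frontier S. f x = 0)}"

end

theory Submission
  imports Defs "HOL-Computational_Algebra.Polynomial"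
begin

text \<open>If the essential supremum on small balls around \<open>x\<close> were below \<open>c\<close>, then almost everywhere near
  \<open>x\<close> the bounded gradient \<open>D\<phi>\<close> would lie in a compact set \<open>K\<close> of vectors \<open>p\<close> with
  \<open>H (x, Du x + \<xi> \<otimes> p) \<le> t' < c\<close>. Matrices \<open>\<xi> \<otimes> p\<close> differ by rank one, so \<open>K\<close> is convex, and
  \<open>0 \<notin> K\<close> because \<open>H (x, Du x) = c\<close>. A hyperplane separating \<open>0\<close> from \<open>K\<close> gives a direction \<open>e\<close>
  with \<open>e \<bullet> D\<phi> \<ge> \<alpha> > 0\<close> almost everywhere near \<open>x\<close>, so \<open>\<phi>\<close> strictly increases along \<open>e\<close>
  through \<open>x\<close>, which excludes a local extremum.\<close>

section \<open>Smooth functions\<close>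

definition smooth :: "(real^'n \<Rightarrow> 'b::real_normed_vector) \<Rightarrow> bool" where
  "smooth f \<longleftrightarrow> (\<forall>k. Ck_on k UNIV f)"

lemma partial_eq:
  assumes "(f has_derivative f') (at x)"
  shows "partial i f x = f' (axis i 1)"
  using frechet_derivative_at[OF assms] by (simp add: partial_def)

text \<open>A differentiable function is continuous, which settles the bottom level. Higher levels
  follow by applying the same claim to the partial derivatives, so \<open>f\<close> must vary in the
  induction.\<close>

lemma Ck_on_decrease: "Ck_on (Suc k) S f \<Longrightarrow> Ck_on k S f"
proof (induction k arbitrary: f)
  case 0
  then have "\<forall>x\<in>S. f differentiable (at x)" by simp
  then show ?case
    by (simp add: continuous_at_imp_continuous_on differentiable_imp_continuous_within)
next
  case (Suc k)
  have *: "\<forall>x\<in>S. f differentiable (at x)" "\<forall>i. Ck_on (Suc k) S (partial i f)"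
    using Suc.prems[unfolded Ck_on.simps(2)[of "Suc k"]] by (rule conjunct1, rule conjunct2)
  show ?case
    unfolding Ck_on.simps(2)[of k S f]
  proof (intro conjI allI)
    show "Ck_on k S (partial i f)" for i
      using *(2) by (intro Suc.IH) (rule spec)
  qed (rule *(1))
qed

text \<open>Order 0 follows from order 1, so it suffices to quantify over successors, and unfolding
  these exposes the partial derivatives.\<close>

lemma smooth_iff_partial:
  "smooth f \<longleftrightarrow> (\<forall>x. f differentiable (at x)) \<and> (\<forall>i. smooth (partial i f))"
proof -
  have "smooth f \<longleftrightarrow> (\<forall>k. Ck_on (Suc k) UNIV f)"
    unfolding smooth_def by (metis Ck_on_decrease)
  then show ?thesis
    by (simp add: smooth_def) metis
qed

lemma smooth_differentiable: "smooth f \<Longrightarrow> f differentiable (at x)"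
  by (simp add: smooth_iff_partial[of f])

lemma smooth_partial: "smooth f \<Longrightarrow> smooth (partial i f)"
  by (simp add: smooth_iff_partial[of f])

lemma smooth_continuous_on: "smooth f \<Longrightarrow> continuous_on S f"
  using continuous_on_subset[of UNIV f S] by (simp add: smooth_def Ck_on.simps(1)[symmetric] del: Ck_on.simps)

text \<open>Replaces \<open>frechet_derivative\<close> by any derivative computed by hand;
  uniqueness of the derivative identifies the two.\<close>

lemma Ck_on_SucI:
  assumes "\<And>x. (f has_derivative f' x) (at x)" "\<And>i. Ck_on k UNIV (\<lambda>x. f' x (axis i 1))"
  shows "Ck_on (Suc k) UNIV f"
proof -
  have "partial i f = (\<lambda>x. f' x (axis i 1))" for i
    using partial_eq[OF assms(1)] by auto
  then show ?thesis using assms by (auto simp: differentiable_def)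
qed

lemma smoothI:
  assumes "\<And>x. (f has_derivative f' x) (at x)" "\<And>i. smooth (\<lambda>x. f' x (axis i 1))"
  shows "smooth f"
  unfolding smooth_def
proof
  fix k show "Ck_on k UNIV f"
    using assms(2) by (simp add: Ck_on_decrease[OF Ck_on_SucI[OF assms(1)]] smooth_def)
qed

section \<open>Algebra and composition of smooth functions\<close>

lemma Ck_on_const: "Ck_on k UNIV (\<lambda>x. c)"
proof (induction k arbitrary: c)
  case (Suc k)
  show ?case by (rule Ck_on_SucI[OF has_derivative_const]) (rule Suc)
qed simp

lemma smooth_const: "smooth (\<lambda>x. c)"
  by (simp add: smooth_def Ck_on_const)

lemma Ck_on_has_derivative:
  "Ck_on (Suc k) UNIV f \<Longrightarrow> (f has_derivative frechet_derivative f (at x)) (at x)"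
  by (simp add: frechet_derivative_works[symmetric])

lemma Ck_on_add:
  "Ck_on k UNIV f \<Longrightarrow> Ck_on k UNIV g \<Longrightarrow> Ck_on k UNIV (\<lambda>x. f x + g x)"
proof (induction k arbitrary: f g)
  case 0
  then show ?case by (simp add: continuous_on_add)
next
  case (Suc k)
  have "Ck_on k UNIV (\<lambda>x. partial i f x + partial i g x)" for i
    using Suc by simp
  then show ?case
    by (intro Ck_on_SucI[OF has_derivative_add[OF Suc.prems[THEN Ck_on_has_derivative]]])
      (simp add: partial_def)
qed

text \<open>Induction with the product rule. The undifferentiated factors are needed at order
  \<open>k\<close> as well, which \<open>Ck_on_decrease\<close> supplies.\<close>

lemma Ck_on_mult:
  fixes f g :: "real^'n \<Rightarrow> real"
  shows "Ck_on k UNIV f \<Longrightarrow> Ck_on k UNIV g \<Longrightarrow> Ck_on k UNIV (\<lambda>x. f x * g x)"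
proof (induction k arbitrary: f g)
  case 0
  then show ?case by (simp add: continuous_on_mult)
next
  case (Suc k)
  have "Ck_on k UNIV (\<lambda>x. f x * partial i g x + partial i f x * g x)" for i
    using Suc.prems Suc.prems[THEN Ck_on_decrease] by (intro Ck_on_add Suc.IH) simp_all
  then show ?case
    by (intro Ck_on_SucI[OF has_derivative_mult[OF Suc.prems[THEN Ck_on_has_derivative]]])
      (simp add: partial_def)
qed

lemma smooth_mult:
  fixes f g :: "real^'n \<Rightarrow> real"
  shows "smooth f \<Longrightarrow> smooth g \<Longrightarrow> smooth (\<lambda>x. f x * g x)"
  by (simp add: smooth_def Ck_on_mult)

lemma smooth_add: "smooth f \<Longrightarrow> smooth g \<Longrightarrow> smooth (\<lambda>x. f x + g x)"
  by (simp add: smooth_def Ck_on_add)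

lemma smooth_diff:
  fixes f g :: "real^'n \<Rightarrow> real"
  assumes "smooth f" "smooth g" shows "smooth (\<lambda>x. f x - g x)"
  using smooth_add[OF assms(1) smooth_mult[OF smooth_const[of "-1"] assms(2)]] by simp

lemma smooth_inner_const: "smooth (\<lambda>x. v \<bullet> (x - a))"
proof (rule smoothI)
  show "((\<lambda>x. v \<bullet> (x - a)) has_derivative (\<lambda>h. v \<bullet> h)) (at x)" for x
    by (auto intro!: derivative_eq_intros)
qed (rule smooth_const)

lemma smooth_dist_square: "smooth (\<lambda>x. (x - a) \<bullet> (x - a))"
proof (rule smoothI)
  show "((\<lambda>x. (x - a) \<bullet> (x - a)) has_derivative (\<lambda>h. 2 * (h \<bullet> (x - a)))) (at x)" for x
    by (auto intro!: derivative_eq_intros simp: inner_commute)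
  show "smooth (\<lambda>x. 2 * (axis i 1 \<bullet> (x - a)))" for i
    by (intro smooth_mult smooth_const smooth_inner_const)
qed

text \<open>Here \<open>D\<close> lists the successive derivatives of the outer function
  \<open>D 0\<close>. The chain rule turns \<open>D j\<close> into \<open>D (Suc j)\<close>, so the
  induction on the order is over all \<open>j\<close> at once.\<close>

lemma smooth_compose:
  fixes f :: "real^'n \<Rightarrow> real" and D :: "nat \<Rightarrow> real \<Rightarrow> real"
  assumes D: "\<And>k t. (D k has_real_derivative D (Suc k) t) (at t)" and f: "smooth f"
  shows "smooth (\<lambda>x. D j (f x))"
  unfolding smooth_def
proof
  fix k show "Ck_on k UNIV (\<lambda>x. D j (f x))"
  proof (induction k arbitrary: j)
    case 0
    have "continuous_on UNIV (D j)"
      by (meson D DERIV_isCont continuous_at_imp_continuous_on)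
    then show ?case
      using continuous_on_compose2[OF _ smooth_continuous_on[OF f]] by fastforce
  next
    case (Suc k)
    have *: "((\<lambda>x. D j (f x)) has_derivative
        (\<lambda>h. D (Suc j) (f x) * frechet_derivative f (at x) h)) (at x)" for x
      using has_derivative_compose[OF
          smooth_differentiable[OF f, unfolded frechet_derivative_works]
          D[unfolded has_field_derivative_def]] .
    have "Ck_on k UNIV (\<lambda>x. D (Suc j) (f x) * partial i f x)" for i
      using smooth_partial[OF f] by (intro Ck_on_mult Suc) (simp add: smooth_def)
    then show ?case
      by (intro Ck_on_SucI[OF *]) (simp add: partial_def)
  qed
qed

section \<open>Test functions on thin tubes\<close>

text \<open>For \<open>p = 1\<close> this is the classical function exp(-1/t), extended by 0, which
  is flat at the origin. The polynomial factor in 1/t makes the family closed under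
  differentiation.\<close>

definition flat :: "real poly \<Rightarrow> real \<Rightarrow> real" where
  "flat p t = (if t > 0 then poly p (1 / t) * exp (- (1 / t)) else 0)"

lemma poly_div_exp_tendsto_0:
  fixes p :: "real poly"
  shows "((\<lambda>y. poly p y / exp y) \<longlongrightarrow> 0) at_top"
proof -
  have "((\<lambda>y. \<Sum>i\<le>degree p. coeff p i * (y ^ i / exp y)) \<longlongrightarrow> (\<Sum>i\<le>degree p. coeff p i * 0)) at_top"
    by (intro tendsto_intros tendsto_power_div_exp_0)
  then show ?thesis
    by (simp add: poly_altdef sum_divide_distrib)
qed

text \<open>With z = 1/t, the derivative of p(z) exp(-z) with respect to t is z^2 (p(z) - p'(z))
  exp(-z), again of the form \<open>flat q\<close>. At 0 the exponential beats every power of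
  z.\<close>

lemma flat_has_derivative:
  "(flat p has_real_derivative flat ([:0, 0, 1:] * (p - pderiv p)) t) (at t)"
proof -
  consider "t > 0" | "t < 0" | "t = 0" by linarith
  then show ?thesis
  proof cases
    case 1
    have "((\<lambda>t. poly p (1 / t) * exp (- (1 / t))) has_real_derivative
        flat ([:0, 0, 1:] * (p - pderiv p)) t) (at t)"
      unfolding flat_def using 1
      by (auto intro!: derivative_eq_intros DERIV_chain'[OF _ poly_DERIV]
          simp: field_simps power2_eq_square)
    then show ?thesis
      by (rule has_field_derivative_transform_within_open[of _ _ _ "{0<..}"])
        (use 1 in \<open>auto simp: flat_def\<close>)
  next
    case 2
    have "((\<lambda>t. 0) has_real_derivative flat ([:0, 0, 1:] * (p - pderiv p)) t) (at t)"
      using 2 by (simp add: flat_def)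
    then show ?thesis
      by (rule has_field_derivative_transform_within_open[of _ _ _ "{..<0}"])
        (use 2 in \<open>auto simp: flat_def\<close>)
  next
    case 3
    \<comment> \<open>The difference quotient at h > 0 is z p(z) / exp z with z = 1/h, and z tends
      to infinity.\<close>
    have "((\<lambda>h. flat p h / h) \<longlongrightarrow> 0) (at_right 0)"
    proof (rule Lim_transform_eventually)
      show "((\<lambda>h. poly ([:0, 1:] * p) (inverse h) / exp (inverse h)) \<longlongrightarrow> 0) (at_right 0)"
        by (rule filterlim_compose[OF poly_div_exp_tendsto_0 filterlim_inverse_at_top_right])
      show "\<forall>\<^sub>F h in at_right 0. poly ([:0, 1:] * p) (inverse h) / exp (inverse h) = flat p h / h"
        by (auto simp: eventually_at_filter flat_def field_simps exp_minus)
    qed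
    moreover have "((\<lambda>h. flat p h / h) \<longlongrightarrow> 0) (at_left 0)"
      by (rule tendsto_eventually) (auto simp: eventually_at_filter flat_def)
    ultimately have "((\<lambda>h. flat p h / h) \<longlongrightarrow> 0) (at 0)"
      by (simp add: filterlim_split_at)
    then show ?thesis
      using 3 by (simp add: has_field_derivative_iff flat_def)
  qed
qed

lemma smooth_flat:
  fixes f :: "real^'n \<Rightarrow> real"
  assumes "smooth f" shows "smooth (\<lambda>x. flat p (f x))"
proof -
  define D where "D k = flat (((\<lambda>p. [:0, 0, 1:] * (p - pderiv p)) ^^ k) p)" for k
  have "(D k has_real_derivative D (Suc k) t) (at t)" for k t
    unfolding D_def using flat_has_derivative by simp
  from smooth_compose[of D, OF this assms, of 0] show ?thesis
    by (simp add: D_def)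
qed

lemma flat_one_pos_iff: "0 < flat 1 t \<longleftrightarrow> 0 < t"
  by (simp add: flat_def)

lemma flat_one_nonneg: "0 \<le> flat 1 t"
  by (simp add: flat_def)

lemma continuous_on_flat: "continuous_on S (flat p)"
  by (meson DERIV_isCont continuous_at_imp_continuous_on flat_has_derivative)

text \<open>With \<open>t = e \<bullet> (y - x)\<close> and \<open>r\<close> the squared distance of \<open>y\<close> from the line \<open>x + \<real> e\<close>, the
  bump is \<open>a = h(t) \<beta>(r)\<close> and \<open>\<psi> = \<integral>\<^sub>0\<^sup>s a(y - \<tau> e) d\<tau> = (F(t) - F(t - s)) \<beta>(r)\<close> for an
  antiderivative \<open>F\<close> of \<open>h\<close>. The product form makes the smoothness of \<open>\<psi>\<close> immediate, without
  differentiating under an integral sign.\<close>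

lemma tube_test_function:
  fixes e x :: "real^'n"
  assumes e: "norm e = 1" and \<epsilon>: "0 < \<epsilon>" and s: "0 < s"
  obtains a \<psi> :: "real^'n \<Rightarrow> real" where
    "continuous_on UNIV a" "\<And>y. 0 \<le> a y" "0 < a x" "\<And>y. a y \<noteq> 0 \<Longrightarrow> dist x y < 2 * \<epsilon>"
    "smooth \<psi>" "\<And>y. 0 \<le> \<psi> y" "\<And>y. \<psi> y \<noteq> 0 \<Longrightarrow> dist x y < s + 2 * \<epsilon>"
    "\<And>y. frechet_derivative \<psi> (at y) e = a y - a (y - s *\<^sub>R e)"
    "integral\<^sup>L lborel \<psi> = s * integral\<^sup>L lborel a"
proof -
  have ee: "e \<bullet> e = 1" using e by (simp add: norm_eq_1)
  define h where "h \<tau> = flat 1 (\<epsilon>\<^sup>2 - \<tau>\<^sup>2)" for \<tau>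
  define t where "t y = e \<bullet> (y - x)" for y
  define r where "r y = (y - x) \<bullet> (y - x) - t y * t y" for y
  define \<beta> where "\<beta> y = flat 1 (\<epsilon>\<^sup>2 - r y)" for y
  define a where "a y = h (t y) * \<beta> y" for y
  have h_cont: "continuous_on S h" for S
    unfolding h_def
    by (rule continuous_on_compose2[OF continuous_on_flat[of UNIV]]) (auto intro!: continuous_intros)
  have h_nonneg: "0 \<le> h \<tau>" for \<tau> unfolding h_def by (rule flat_one_nonneg)
  have h_nz: "\<bar>\<tau>\<bar> < \<epsilon>" if "h \<tau> \<noteq> 0" for \<tau>
  proof -
    have "\<bar>\<tau>\<bar>\<^sup>2 < \<epsilon>\<^sup>2"
      using that h_nonneg[of \<tau>] flat_one_pos_iff[of "\<epsilon>\<^sup>2 - \<tau>\<^sup>2"] by (simp add: h_def)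
    then show ?thesis
      using \<epsilon> by (rule power2_less_imp_less[OF _ less_imp_le])
  qed
  have \<beta>_nonneg: "0 \<le> \<beta> y" for y by (simp add: \<beta>_def flat_one_nonneg)
  have \<beta>_nz: "r y < \<epsilon>\<^sup>2" if "\<beta> y \<noteq> 0" for y
    using that \<beta>_nonneg[of y] flat_one_pos_iff[of "\<epsilon>\<^sup>2 - r y"] by (simp add: \<beta>_def)
  have smooth_t: "smooth t" unfolding t_def by (rule smooth_inner_const)
  have smooth_\<beta>: "smooth \<beta>"
    unfolding \<beta>_def r_def
    by (intro smooth_flat smooth_diff smooth_const smooth_dist_square smooth_mult smooth_t)
  have t_shift: "t (y - \<tau> *\<^sub>R e) = t y - \<tau>" for y \<tau>
    by (simp add: t_def inner_diff_right ee)
  \<comment> \<open>A translation along \<open>e\<close> preserves the distance from the line x +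
    \<real> e, and \<beta> depends on that distance only.\<close>
  have \<beta>_shift: "\<beta> (y - \<tau> *\<^sub>R e) = \<beta> y" for y \<tau>
    unfolding \<beta>_def r_def t_shift
    by (simp add: t_def inner_diff_right inner_diff_left ee inner_commute algebra_simps)
  obtain F where F: "\<And>\<tau>. (F has_real_derivative h \<tau>) (at \<tau>)"
  proof -
    have "\<exists>F. \<forall>\<tau>::real. -\<infinity> < ereal \<tau> \<longrightarrow> \<tau> < \<infinity> \<longrightarrow> (F has_vector_derivative h \<tau>) (at \<tau>)"
      using h_cont[of UNIV] by (intro einterval_antiderivative) (auto simp: continuous_on_eq_continuous_at)
    then show ?thesis
      using that by (auto simp: has_real_derivative_iff_has_vector_derivative)
  qed
  define A where "A \<tau> = F \<tau> - F (\<tau> - s)" for \<tau>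
  define \<psi> where "\<psi> y = A (t y) * \<beta> y" for y
  have A_deriv: "(A has_real_derivative h \<tau> - h (\<tau> - s)) (at \<tau>)" for \<tau>
    unfolding A_def by (auto intro!: derivative_eq_intros DERIV_chain'[OF _ F] F)
  \<comment> \<open>The mean value theorem writes \<open>A\<close> as \<open>s\<close> times a value
    of \<open>h\<close> at a point of the window. This gives both the sign and the support of
    \<open>A\<close>.\<close>
  have A_mvt: "\<exists>\<sigma>. \<tau> - s < \<sigma> \<and> \<sigma> < \<tau> \<and> A \<tau> = s * h \<sigma>" for \<tau>
    using MVT2[of "\<tau> - s" \<tau> F h] F s by (auto simp: A_def)
  have A_nonneg: "0 \<le> A \<tau>" for \<tau>
    using A_mvt[of \<tau>] h_nonneg s by auto
  have A_nz: "-\<epsilon> < \<tau> \<and> \<tau> < s + \<epsilon>" if "A \<tau> \<noteq> 0" for \<tau>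
    using A_mvt[of \<tau>] that h_nz by fastforce
  have smooth_h: "smooth (\<lambda>y. h (t y))"
    unfolding h_def power2_eq_square
    by (intro smooth_flat smooth_diff smooth_const smooth_mult smooth_t)
  have smooth_hs: "smooth (\<lambda>y. h (t y - s))"
    unfolding h_def power2_eq_square
    by (intro smooth_flat smooth_diff smooth_const smooth_mult smooth_t)
  have t_deriv: "(t has_derivative (\<lambda>v. e \<bullet> v)) (at y)" for y
    unfolding t_def by (auto intro!: derivative_eq_intros)
  have At_deriv: "((\<lambda>y. A (t y)) has_derivative (\<lambda>v. (h (t y) - h (t y - s)) * (e \<bullet> v))) (at y)" for y
    using has_derivative_compose[OF t_deriv A_deriv[unfolded has_field_derivative_def]] .
  have smooth_\<psi>: "smooth \<psi>"
    unfolding \<psi>_def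
    by (intro smooth_mult smooth_\<beta> smoothI[OF At_deriv] smooth_diff smooth_h smooth_hs smooth_const)
  \<comment> \<open>Pythagoras for the components along \<open>e\<close> and orthogonal to it; it
    turns bounds on \<open>t\<close> and \<open>r\<close> into bounds on the distance from
    \<open>x\<close>.\<close>
  have tsq: "(dist x y)\<^sup>2 = r y + (t y)\<^sup>2" for y
    by (simp add: r_def dist_norm power2_norm_eq_inner power2_eq_square[of "t y"]
        inner_diff_left inner_diff_right inner_commute)
  show ?thesis
  proof
    have cont_\<beta>: "continuous_on UNIV \<beta>" using smooth_\<beta> by (rule smooth_continuous_on)
    have cont_t: "continuous_on UNIV t" using smooth_t by (rule smooth_continuous_on)
    show cont_a: "continuous_on UNIV a"
      unfolding a_def
      by (intro continuous_on_mult cont_\<beta> smooth_continuous_on[OF smooth_h])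
    show a_nonneg: "0 \<le> a y" for y by (simp add: a_def h_nonneg \<beta>_nonneg)
    show "0 < a x"
      using \<epsilon> by (simp add: a_def h_def \<beta>_def t_def r_def flat_one_pos_iff)
    show "dist x y < 2 * \<epsilon>" if "a y \<noteq> 0" for y
    proof -
      have "\<bar>t y\<bar> < \<epsilon>" "r y < \<epsilon>\<^sup>2" using that h_nz \<beta>_nz by (auto simp: a_def)
      then have "(dist x y)\<^sup>2 < \<epsilon>\<^sup>2 + \<epsilon>\<^sup>2"
        unfolding tsq using power_strict_mono[of "\<bar>t y\<bar>" \<epsilon> 2] by simp
      also have "\<dots> \<le> (2 * \<epsilon>)\<^sup>2" by (simp add: power2_eq_square)
      finally show ?thesis by (rule power2_less_imp_less) (use \<epsilon> in simp)
    qed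
    show "smooth \<psi>" by fact
    show \<psi>_nonneg: "0 \<le> \<psi> y" for y by (simp add: \<psi>_def A_nonneg \<beta>_nonneg)
    show "dist x y < s + 2 * \<epsilon>" if "\<psi> y \<noteq> 0" for y
    proof -
      have *: "-\<epsilon> < t y" "t y < s + \<epsilon>" "r y < \<epsilon>\<^sup>2" using that A_nz \<beta>_nz by (auto simp: \<psi>_def)
      then have "(t y)\<^sup>2 \<le> (s + \<epsilon>)\<^sup>2" using s \<epsilon> by (intro power2_le_iff_abs_le[THEN iffD2]) auto
      with * have "(dist x y)\<^sup>2 < \<epsilon>\<^sup>2 + (s + \<epsilon>)\<^sup>2"
        unfolding tsq by linarith
      also have "\<dots> \<le> (s + 2 * \<epsilon>)\<^sup>2" using s \<epsilon> by (simp add: power2_eq_square algebra_simps)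
      finally show ?thesis by (rule power2_less_imp_less) (use s \<epsilon> in simp)
    qed
    show "frechet_derivative \<psi> (at y) e = a y - a (y - s *\<^sub>R e)" for y
    proof -
      \<comment> \<open>The constant \<open>c\<close> obtained below stays unspecified: in direction
        \<open>e\<close> the derivative of \<open>r\<close> is 2 t(y) - 2 t(y) = 0, so only the
        factor \<open>A (t y)\<close> contributes.\<close>
      have "((\<lambda>y. \<epsilon>\<^sup>2 - r y) has_derivative (\<lambda>v. - (2 * (v \<bullet> (y - x)) - 2 * t y * (e \<bullet> v)))) (at y)"
        unfolding r_def
        by (auto intro!: derivative_eq_intros t_deriv simp: inner_commute algebra_simps)
      from has_derivative_compose[OF this flat_has_derivative[of 1, unfolded has_field_derivative_def]]
      obtain c where "(\<beta> has_derivative (\<lambda>v. c * - (2 * (v \<bullet> (y - x)) - 2 * t y * (e \<bullet> v)))) (at y)"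
        unfolding \<beta>_def[abs_def] by auto
      from has_derivative_mult[OF At_deriv this]
      have "frechet_derivative \<psi> (at y) = (\<lambda>v. A (t y) * (c * - (2 * (v \<bullet> (y - x)) - 2 * t y * (e \<bullet> v))) +
          (h (t y) - h (t y - s)) * (e \<bullet> v) * \<beta> y)"
        unfolding \<psi>_def[abs_def] by (rule frechet_derivative_at[symmetric])
      then show ?thesis
        unfolding a_def t_shift \<beta>_shift by (simp add: ee t_def[symmetric] left_diff_distrib)
    qed
    have [measurable]: "h \<in> borel_measurable borel" "\<beta> \<in> borel_measurable borel"
        "t \<in> borel_measurable borel" "a \<in> borel_measurable borel" "\<psi> \<in> borel_measurable borel"
      using h_cont cont_\<beta> cont_t cont_a smooth_continuous_on[OF smooth_\<psi>]
      by (auto intro!: borel_measurable_continuous_onI)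
    \<comment> \<open>This is \<psi> as an average of translates of \<open>a\<close>. In nonnegative
      extended integrals, Tonelli and translation invariance then give the integral of
      \<psi>.\<close>
    have \<psi>_eq: "ennreal (\<psi> y) = (\<integral>\<^sup>+\<tau>. ennreal (a (y - \<tau> *\<^sub>R e)) * indicator {0..s} \<tau> \<partial>lborel)" for y
    proof -
      have "(\<integral>\<^sup>+\<tau>. ennreal (a (y - \<tau> *\<^sub>R e)) * indicator {0..s} \<tau> \<partial>lborel)
          = - F (t y - s) * \<beta> y - (- F (t y - 0) * \<beta> y)"
      proof (rule nn_integral_FTC_Icc)
        show "((\<lambda>\<tau>. - F (t y - \<tau>) * \<beta> y) has_real_derivative a (y - \<tau> *\<^sub>R e)) (at \<tau>)" for \<tau>
          unfolding a_def t_shift \<beta>_shift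
          by (auto intro!: derivative_eq_intros DERIV_chain'[OF _ F])
      qed (use s a_nonneg in auto)
      then show ?thesis by (simp add: \<psi>_def A_def algebra_simps)
    qed
    have shift: "(\<integral>\<^sup>+y. ennreal (a (y - \<tau> *\<^sub>R e)) \<partial>lborel) = (\<integral>\<^sup>+y. ennreal (a y) \<partial>lborel)" for \<tau>
    proof -
      have "(\<integral>\<^sup>+y. ennreal (a y) \<partial>lborel) = (\<integral>\<^sup>+y. ennreal (a y) \<partial>distr lborel borel ((+) (- \<tau> *\<^sub>R e)))"
        by (simp add: lborel_distr_plus)
      also have "\<dots> = (\<integral>\<^sup>+y. ennreal (a (- \<tau> *\<^sub>R e + y)) \<partial>lborel)"
        by (rule nn_integral_distr) auto
      finally show ?thesis by simp
    qed
    have "(\<integral>\<^sup>+y. ennreal (\<psi> y) \<partial>lborel)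
        = (\<integral>\<^sup>+y. \<integral>\<^sup>+\<tau>. ennreal (a (y - \<tau> *\<^sub>R e)) * indicator {0..s} \<tau> \<partial>lborel \<partial>lborel)"
      by (simp add: \<psi>_eq)
    also have "\<dots> = (\<integral>\<^sup>+\<tau>. \<integral>\<^sup>+y. ennreal (a (y - \<tau> *\<^sub>R e)) * indicator {0..s} \<tau> \<partial>lborel \<partial>lborel)"
      by (rule lborel_pair.Fubini') measurable
    also have "\<dots> = (\<integral>\<^sup>+\<tau>. (\<integral>\<^sup>+y. ennreal (a y) \<partial>lborel) * indicator {0..s} (\<tau>::real) \<partial>lborel)"
      by (simp add: nn_integral_multc shift)
    also have "\<dots> = (\<integral>\<^sup>+y. ennreal (a y) \<partial>lborel) * ennreal s"
      using s by (simp add: nn_integral_cmult)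
    finally have "(\<integral>\<^sup>+y. ennreal (\<psi> y) \<partial>lborel) = (\<integral>\<^sup>+y. ennreal (a y) \<partial>lborel) * ennreal s" .
    then show "integral\<^sup>L lborel \<psi> = s * integral\<^sup>L lborel a"
      using s by (simp add: integral_eq_nn_integral \<psi>_nonneg a_nonneg enn2real_mult)
  qed
qed

section \<open>Weak gradients and local extrema\<close>

text \<open>A nonempty open set is not negligible, so it cannot lie inside the exceptional null
  set.\<close>

lemma AE_lebesgue_open:
  fixes U :: "'a::euclidean_space set"
  assumes "AE y in lebesgue. P y" "open U" "U \<noteq> {}"
  obtains y where "y \<in> U" "P y"
proof (rule ccontr)
  assume "\<not> thesis"
  then have sub: "U \<subseteq> {y \<in> space lebesgue. \<not> P y}" using that by auto
  obtain N where "N \<in> null_sets lebesgue" "{y \<in> space lebesgue. \<not> P y} \<subseteq> N"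
    using assms(1) by (auto simp: eventually_ae_filter)
  then have "negligible U"
    using sub negligible_iff_null_sets negligible_subset by blast
  then show False using assms open_not_negligible by blast
qed

lemma integral_lebesgue_on_support:
  fixes f :: "'a::euclidean_space \<Rightarrow> real"
  assumes "f \<in> borel_measurable borel" "S \<in> sets lebesgue" "\<And>y. f y \<noteq> 0 \<Longrightarrow> y \<in> S"
  shows "integral\<^sup>L (lebesgue_on S) f = integral\<^sup>L lborel f"
proof -
  have "integral\<^sup>L (lebesgue_on S) f = integral\<^sup>L lebesgue (\<lambda>y. indicator S y *\<^sub>R f y)"
    using assms(2) by (simp add: integral_restrict_space)
  also have "(\<lambda>y. indicator S y *\<^sub>R f y) = f"
    using assms(3) by (fastforce simp: indicator_def)
  finally show ?thesis using assms(1) by (simp add: integral_completion)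
qed

text \<open>On the compact closure of \<open>S\<close> the factor \<open>k\<close> is bounded, so
  the product is essentially bounded on a set of finite measure.\<close>

lemma Linf_mult_continuous_integrable:
  fixes f k :: "'a::euclidean_space \<Rightarrow> real"
  assumes "f \<in> Linf S" "continuous_on UNIV k" "open S" "bounded S"
  shows "integrable (lebesgue_on S) (\<lambda>y. f y * k y)"
proof -
  have S: "S \<in> lmeasurable" using assms by (simp add: lmeasurable_open)
  interpret finite_measure "lebesgue_on S" using S by (rule finite_measure_lebesgue_on)
  have [measurable]: "f \<in> borel_measurable (lebesgue_on S)" "k \<in> borel_measurable (lebesgue_on S)"
    using assms S
    by (auto simp: Linf_def fmeasurableD intro!: continuous_imp_measurable_on_sets_lebesgue
        intro: continuous_on_subset)
  obtain B where B: "AE y in lebesgue_on S. norm (f y) \<le> B" using assms(1) by (auto simp: Linf_def)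
  have "compact (k ` closure S)"
    using assms by (intro compact_continuous_image) (auto intro: continuous_on_subset simp: compact_closure)
  then obtain C where C: "\<And>y. y \<in> closure S \<Longrightarrow> norm (k y) \<le> C"
    by (meson bounded_iff compact_imp_bounded imageI)
  have "AE y in lebesgue_on S. norm (f y * k y) \<le> B * C"
    using B AE_space[of "lebesgue_on S"]
  proof eventually_elim
    case (elim y)
    then have "y \<in> closure S" using closure_subset by auto
    with elim C[of y] show ?case
      unfolding norm_mult by (intro mult_mono) (auto intro: order_trans[OF norm_ge_zero])
  qed
  then show ?thesis by (rule integrable_const_bound) measurable
qed

lemma Linf_nth:
  fixes g :: "'a::euclidean_space \<Rightarrow> real^'n"
  assumes "g \<in> Linf S" shows "(\<lambda>y. g y $ i) \<in> Linf S"
proof -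
  have "(\<lambda>y. g y \<bullet> axis i 1) \<in> borel_measurable (lebesgue_on S)"
    using assms by (auto simp: Linf_def)
  moreover obtain B where B: "AE y in lebesgue_on S. norm (g y) \<le> B" using assms by (auto simp: Linf_def)
  then have "AE y in lebesgue_on S. norm (g y $ i) \<le> B"
    by eventually_elim (metis component_le_norm_cart order_trans real_norm_def)
  ultimately show ?thesis by (auto simp: Linf_def inner_axis)
qed

lemma frechet_derivative_eq_sum_partial:
  assumes "f differentiable (at y)"
  shows "frechet_derivative f (at y) e = (\<Sum>i\<in>UNIV. e $ i *\<^sub>R partial i f y)"
proof -
  have "frechet_derivative f (at y) (\<Sum>i\<in>UNIV. e $ i *\<^sub>R axis i 1) = (\<Sum>i\<in>UNIV. e $ i *\<^sub>R partial i f y)"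
    using linear_frechet_derivative[OF assms]
    by (simp add: linear_sum linear_scale partial_def)
  moreover have "(\<Sum>i\<in>UNIV. e $ i *\<^sub>R axis i 1) = e"
    using basis_expansion[of e] by (simp add: scalar_mult_eq_scaleR)
  ultimately show ?thesis by simp
qed

text \<open>The coordinate identities are combined with weights \<open>e $ i\<close>; integrability
  of each term allows the sum to pass through the integral.\<close>

lemma weak_gradient_directional:
  assumes \<phi>: "\<phi> \<in> Linf S" and g: "Linf_weak_gradient S \<phi> g" and S: "open S" "bounded S"
    and \<psi>: "test_function S \<psi>"
  shows "(LINT y|lebesgue_on S. \<phi> y * frechet_derivative \<psi> (at y) e)
    = - (LINT y|lebesgue_on S. (e \<bullet> g y) * \<psi> y)"
proof -
  have smooth: "smooth \<psi>" using \<psi> by (simp add: test_function_def smooth_def)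
  have int1: "integrable (lebesgue_on S) (\<lambda>y. \<phi> y * partial i \<psi> y)" for i
    by (intro Linf_mult_continuous_integrable \<phi> S smooth_continuous_on smooth_partial smooth)
  have int2: "integrable (lebesgue_on S) (\<lambda>y. g y $ i * \<psi> y)" for i
    using g by (intro Linf_mult_continuous_integrable Linf_nth S smooth_continuous_on smooth)
      (simp add: Linf_weak_gradient_def)
  have "(LINT y|lebesgue_on S. \<phi> y * frechet_derivative \<psi> (at y) e)
      = (LINT y|lebesgue_on S. (\<Sum>i\<in>UNIV. e $ i * (\<phi> y * partial i \<psi> y)))"
    by (simp add: frechet_derivative_eq_sum_partial smooth_differentiable smooth sum_distrib_left mult.left_commute)
  also have "\<dots> = (\<Sum>i\<in>UNIV. e $ i * (LINT y|lebesgue_on S. \<phi> y * partial i \<psi> y))"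
    using int1 by (simp add: integral_sum)
  also have "\<dots> = (\<Sum>i\<in>UNIV. e $ i * - (LINT y|lebesgue_on S. g y $ i * \<psi> y))"
    using g \<psi> by (simp add: Linf_weak_gradient_def)
  also have "\<dots> = - (LINT y|lebesgue_on S. (\<Sum>i\<in>UNIV. e $ i * (g y $ i * \<psi> y)))"
    using int2 by (simp add: integral_sum sum_negf)
  also have "\<dots> = - (LINT y|lebesgue_on S. (e \<bullet> g y) * \<psi> y)"
    by (simp add: inner_vec_def sum_distrib_right mult.assoc)
  finally show ?thesis .
qed

text \<open>Testing the weak gradient with \<open>\<psi>\<close> from \<open>tube_test_function\<close>: the integral of \<open>\<phi> (a - b)\<close>, where \<open>b\<close> is \<open>a\<close>
  moved by \<open>s e\<close>, is at most \<open>- \<alpha> s \<integral> a\<close>, whereas continuity at \<open>x\<close> (for \<open>a\<close>) and maximality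
  (for \<open>b\<close>) bound it from below by \<open>- \<kappa> \<integral> a\<close> with \<open>\<kappa> = \<alpha> s / 2\<close>.\<close>

lemma no_local_max_if_weak_gradient_directed:
  fixes \<phi> :: "real^'n \<Rightarrow> real"
  assumes S: "open S" "bounded S" and \<phi>: "\<phi> \<in> Linf S" "continuous_on S \<phi>"
    and g: "Linf_weak_gradient S \<phi> g" and e: "norm e = 1" and \<alpha>: "0 < \<alpha>"
    and \<delta>: "0 < \<delta>" "ball x \<delta> \<subseteq> S"
    and AE: "AE y in lebesgue_on S. y \<in> ball x \<delta> \<longrightarrow> \<alpha> \<le> e \<bullet> g y"
    and max: "\<And>y. y \<in> ball x \<delta> \<Longrightarrow> \<phi> y \<le> \<phi> x"
  shows False
proof -
  define s where "s = \<delta> / 2"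
  define \<kappa> where "\<kappa> = \<alpha> * s / 2"
  have s: "0 < s" using \<delta> by (simp add: s_def)
  have \<kappa>: "0 < \<kappa>" using \<alpha> s by (simp add: \<kappa>_def)
  have "isCont \<phi> x"
    using \<phi>(2) S(1) \<delta> by (metis centre_in_ball continuous_on_eq_continuous_at subsetD)
  then obtain d where d: "0 < d" "\<And>y. dist x y < d \<Longrightarrow> dist (\<phi> y) (\<phi> x) < \<kappa>"
    using \<kappa> unfolding continuous_at_eps_delta dist_norm by (metis norm_minus_commute)
  \<comment> \<open>The bound d/2 puts the support of \<open>a\<close> where \<phi> is within
    \<kappa> of its value at \<open>x\<close>. The bound \<delta>/8 gives s + 2 \<epsilon> \<le> 3
    \<delta>/4, so \<psi> and \<open>b\<close> vanish outside the ball of radius \<delta>.\<close>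
  define \<epsilon> where "\<epsilon> = min (d / 2) (\<delta> / 8)"
  have \<epsilon>: "0 < \<epsilon>" "2 * \<epsilon> \<le> d" "s + 2 * \<epsilon> < \<delta>" using d \<delta> by (auto simp: \<epsilon>_def s_def)
  obtain a \<psi> :: "real^'n \<Rightarrow> real" where a: "continuous_on UNIV a" "\<And>y. 0 \<le> a y" "0 < a x"
      "\<And>y. a y \<noteq> 0 \<Longrightarrow> dist x y < 2 * \<epsilon>"
    and \<psi>: "smooth \<psi>" "\<And>y. 0 \<le> \<psi> y" "\<And>y. \<psi> y \<noteq> 0 \<Longrightarrow> dist x y < s + 2 * \<epsilon>"
    and \<psi>_deriv: "\<And>y. frechet_derivative \<psi> (at y) e = a y - a (y - s *\<^sub>R e)"
    and \<psi>_int: "integral\<^sup>L lborel \<psi> = s * integral\<^sup>L lborel a"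
    by (rule tube_test_function[OF e \<epsilon>(1) s, of x]) (rule that; assumption)
  define b where "b y = a (y - s *\<^sub>R e)" for y
  have b_cont: "continuous_on UNIV b"
    unfolding b_def by (rule continuous_on_compose2[OF a(1)]) (auto intro!: continuous_intros)
  have b_nz: "dist x y < s + 2 * \<epsilon>" if "b y \<noteq> 0" for y
  proof -
    have "dist x (y - s *\<^sub>R e) < 2 * \<epsilon>" using that a(4) by (simp add: b_def)
    moreover have "dist (y - s *\<^sub>R e) y = s" using e s by (simp add: dist_norm)
    ultimately show ?thesis using dist_triangle[of x y "y - s *\<^sub>R e"] by linarith
  qed
  have in_S: "y \<in> S" if "dist x y < s + 2 * \<epsilon>" for y
    using that \<epsilon> by (intro subsetD[OF \<delta>(2)]) simp
  have test: "test_function S \<psi>"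
  proof -
    have sub: "closure {y. \<psi> y \<noteq> 0} \<subseteq> cball x (s + 2 * \<epsilon>)"
      by (rule closure_minimal) (auto dest!: \<psi>(3))
    also have "\<dots> \<subseteq> S" by (rule order_trans[OF _ \<delta>(2)]) (use \<epsilon> in auto)
    finally show ?thesis
      using \<psi>(1) bounded_subset[OF bounded_cball sub]
      by (auto simp: test_function_def smooth_def compact_eq_bounded_closed)
  qed
  have S': "S \<in> sets lebesgue" using S by simp
  have one: "(\<lambda>y. 1::real) \<in> Linf S" by (auto simp: Linf_def)
  have int_cont: "integrable (lebesgue_on S) k" if "continuous_on UNIV k" for k :: "real^'n \<Rightarrow> real"
    using Linf_mult_continuous_integrable[OF one that S] by simp
  define I where "I = integral\<^sup>L lborel a"
  have [measurable]: "a \<in> borel_measurable borel" "b \<in> borel_measurable borel" "\<psi> \<in> borel_measurable borel"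
    using a(1) b_cont smooth_continuous_on[OF \<psi>(1)] by (auto intro!: borel_measurable_continuous_onI)
  have a_S: "y \<in> S" if "a y \<noteq> 0" for y using a(4)[OF that] s by (intro in_S) simp
  have int_a: "integral\<^sup>L (lebesgue_on S) a = I"
    unfolding I_def by (rule integral_lebesgue_on_support[OF _ S' a_S]) auto
  have int_b: "integral\<^sup>L (lebesgue_on S) b = I"
  proof -
    have "integral\<^sup>L (lebesgue_on S) b = integral\<^sup>L lborel b"
      by (rule integral_lebesgue_on_support[OF _ S' in_S[OF b_nz]]) auto
    also have "\<dots> = integral\<^sup>L (distr lborel borel ((+) (- s *\<^sub>R e))) a"
      by (subst integral_distr) (auto simp: b_def[abs_def])
    also have "\<dots> = I" by (simp add: lborel_distr_plus I_def)
    finally show ?thesis .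
  qed
  have int_\<psi>: "integral\<^sup>L (lebesgue_on S) \<psi> = s * I"
    unfolding I_def \<psi>_int[symmetric]
    by (rule integral_lebesgue_on_support[OF _ S' in_S[OF \<psi>(3)]]) auto
  \<comment> \<open>If the integral vanished, \<open>a\<close> would be zero almost everywhere in
    \<open>S\<close>, contradicting its positivity on an open set around \<open>x\<close>.\<close>
  have "0 < I"
  proof (rule ccontr)
    assume "\<not> 0 < I"
    moreover have "0 \<le> I" unfolding I_def by (rule Bochner_Integration.integral_nonneg) (rule a)
    ultimately have "integral\<^sup>L (lebesgue_on S) a = 0" using int_a by simp
    then have "AE y in lebesgue_on S. a y = 0"
      using integral_nonneg_eq_0_iff_AE[OF int_cont[OF a(1)]] a(2) by simp
    then have "AE y in lebesgue. y \<in> S \<longrightarrow> a y = 0"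
      using S' by (simp add: AE_restrict_space_iff)
    moreover have "open {y. 0 < a y}"
      using a(1) by (intro open_Collect_less) (auto intro: continuous_intros)
    ultimately obtain y where "0 < a y" "y \<in> S \<longrightarrow> a y = 0"
      using a(3) by (auto elim: AE_lebesgue_open)
    then show False using a_S[of y] by simp
  qed
  have "(\<phi> x - \<kappa>) * I - \<phi> x * I = (LINT y|lebesgue_on S. (\<phi> x - \<kappa>) * a y - \<phi> x * b y)"
    using int_cont[OF a(1)] int_cont[OF b_cont] by (simp add: int_a int_b)
  also have "\<dots> \<le> (LINT y|lebesgue_on S. \<phi> y * (a y - b y))"
  proof (rule integral_mono)
    show "integrable (lebesgue_on S) (\<lambda>y. (\<phi> x - \<kappa>) * a y - \<phi> x * b y)"
      using int_cont[OF a(1)] int_cont[OF b_cont] by simp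
    show "integrable (lebesgue_on S) (\<lambda>y. \<phi> y * (a y - b y))"
      by (intro Linf_mult_continuous_integrable \<phi> S continuous_on_diff a b_cont)
    show "(\<phi> x - \<kappa>) * a y - \<phi> x * b y \<le> \<phi> y * (a y - b y)" for y
    proof -
      have "(\<phi> x - \<kappa>) * a y \<le> \<phi> y * a y"
      proof (cases "a y = 0")
        case False
        then have "dist (\<phi> y) (\<phi> x) < \<kappa>" using a(4)[of y] d \<epsilon> by auto
        then show ?thesis using a(2) by (intro mult_right_mono) (auto simp: dist_real_def)
      qed simp
      moreover have "\<phi> y * b y \<le> \<phi> x * b y"
      proof (cases "b y = 0")
        case False
        then have "\<phi> y \<le> \<phi> x" using b_nz[of y] \<epsilon> by (intro max) simp
        then show ?thesis using a(2) by (intro mult_right_mono) (auto simp: b_def)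
      qed simp
      ultimately show ?thesis by (simp add: right_diff_distrib)
    qed
  qed
  also have "\<dots> = - (LINT y|lebesgue_on S. (e \<bullet> g y) * \<psi> y)"
    using weak_gradient_directional[OF \<phi>(1) g S test, of e] by (simp add: \<psi>_deriv b_def)
  also have "\<dots> \<le> - (LINT y|lebesgue_on S. \<alpha> * \<psi> y)"
  proof -
    have "(LINT y|lebesgue_on S. \<alpha> * \<psi> y) \<le> (LINT y|lebesgue_on S. (e \<bullet> g y) * \<psi> y)"
    proof (rule integral_mono_AE)
      show "integrable (lebesgue_on S) (\<lambda>y. \<alpha> * \<psi> y)"
        using int_cont[OF smooth_continuous_on[OF \<psi>(1)]] by simp
      have "integrable (lebesgue_on S) (\<lambda>y. \<Sum>i\<in>UNIV. e $ i * (g y $ i * \<psi> y))"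
        using g by (intro Bochner_Integration.integrable_sum integrable_mult_right
            Linf_mult_continuous_integrable Linf_nth S smooth_continuous_on \<psi>)
          (simp add: Linf_weak_gradient_def)
      then show "integrable (lebesgue_on S) (\<lambda>y. (e \<bullet> g y) * \<psi> y)"
        by (simp add: inner_vec_def sum_distrib_right mult.assoc)
      show "AE y in lebesgue_on S. \<alpha> * \<psi> y \<le> (e \<bullet> g y) * \<psi> y"
        using AE
      proof eventually_elim
        case (elim y)
        then show ?case
          using \<psi>(2,3)[of y] \<epsilon> by (cases "\<psi> y = 0") (auto intro: mult_right_mono)
      qed
    qed
    then show ?thesis by simp
  qed
  also have "\<dots> = - (\<alpha> * s * I)" by (simp add: int_\<psi>)
  \<comment> \<open>The chain starts at -\<kappa> I = -\<alpha> s I / 2 and ends at -\<alpha> s I,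
    which is smaller because \<alpha>, \<open>s\<close> and \<open>I\<close> are positive.\<close>
  finally have "\<alpha> * s * I \<le> \<alpha> * s / 2 * I" by (simp add: \<kappa>_def algebra_simps)
  then show False using \<open>0 < I\<close> \<alpha> s by (simp add: mult_le_cancel_right)
qed

lemma Linf_uminus: "f \<in> Linf S \<Longrightarrow> (\<lambda>y. - f y) \<in> Linf S"
  by (auto simp: Linf_def)

lemma Linf_weak_gradient_uminus:
  "Linf_weak_gradient S f g \<Longrightarrow> Linf_weak_gradient S (\<lambda>y. - f y) (\<lambda>y. - g y)"
  by (simp add: Linf_weak_gradient_def Linf_uminus)

text \<open>A minimum of \<phi> is a maximum of -\<phi>. Replacing \<open>g\<close> by
  \<open>- g\<close> and \<open>e\<close> by \<open>- e\<close> keeps the inner product, hence the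
  lower bound \<alpha>.\<close>

lemma no_local_extremum_if_weak_gradient_directed:
  fixes \<phi> :: "real^'n \<Rightarrow> real"
  assumes S: "open S" "bounded S" and \<phi>: "\<phi> \<in> Linf S" "continuous_on S \<phi>"
    and g: "Linf_weak_gradient S \<phi> g" and e: "norm e = 1" and \<alpha>: "0 < \<alpha>"
    and x: "x \<in> S" and \<delta>: "0 < \<delta>"
    and AE: "AE y in lebesgue_on S. y \<in> ball x \<delta> \<longrightarrow> \<alpha> \<le> e \<bullet> g y"
  shows "\<not> ((\<forall>\<^sub>F y in nhds x. \<phi> y \<le> \<phi> x) \<or> (\<forall>\<^sub>F y in nhds x. \<phi> x \<le> \<phi> y))"
proof
  obtain r where r: "0 < r" "ball x r \<subseteq> S" using S(1) x open_contains_ball by blast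
  assume "(\<forall>\<^sub>F y in nhds x. \<phi> y \<le> \<phi> x) \<or> (\<forall>\<^sub>F y in nhds x. \<phi> x \<le> \<phi> y)"
  then show False
  proof
    assume "\<forall>\<^sub>F y in nhds x. \<phi> y \<le> \<phi> x"
    then obtain d where d: "0 < d" "\<And>y. dist y x < d \<Longrightarrow> \<phi> y \<le> \<phi> x"
      by (auto simp: eventually_nhds_metric)
    show False
    proof (rule no_local_max_if_weak_gradient_directed[OF S \<phi> g e \<alpha>, of "min r (min d \<delta>)" x])
      show "AE y in lebesgue_on S. y \<in> ball x (min r (min d \<delta>)) \<longrightarrow> \<alpha> \<le> e \<bullet> g y"
        using AE by eventually_elim auto
    qed (use r d \<delta> in \<open>auto simp: dist_commute\<close>)
  next
    assume "\<forall>\<^sub>F y in nhds x. \<phi> x \<le> \<phi> y"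
    then obtain d where d: "0 < d" "\<And>y. dist y x < d \<Longrightarrow> \<phi> x \<le> \<phi> y"
      by (auto simp: eventually_nhds_metric)
    show False
    proof (rule no_local_max_if_weak_gradient_directed[OF S Linf_uminus[OF \<phi>(1)]
          continuous_on_minus[OF \<phi>(2)] Linf_weak_gradient_uminus[OF g], of "- e" \<alpha> "min r (min d \<delta>)" x])
      show "AE y in lebesgue_on S. y \<in> ball x (min r (min d \<delta>)) \<longrightarrow> \<alpha> \<le> - e \<bullet> - g y"
        using AE by eventually_elim auto
    qed (use r d \<delta> \<alpha> e in \<open>auto simp: dist_commute\<close>)
  qed
qed

section \<open>Rank-one convexity and essential suprema\<close>

text \<open>Every row is a multiple of \<open>p\<close>, so the row space lies in a line.\<close>

lemma rank_tensor_le_1: "rank (\<xi> \<otimes>\<^sub>v p) \<le> 1"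
proof -
  have "row i (\<xi> \<otimes>\<^sub>v p) = \<xi> $ i *\<^sub>R p" for i
    by (simp add: row_def tensor_def vec_eq_iff)
  then have "rows (\<xi> \<otimes>\<^sub>v p) \<subseteq> span {p}"
    by (auto simp: rows_def span_scale span_base)
  then have "dim (rows (\<xi> \<otimes>\<^sub>v p)) \<le> card {p}"
    by (intro dim_le_card) auto
  then show ?thesis by (simp add: row_rank_def)
qed

text \<open>The map sending \<open>p\<close> to \<open>P + \<xi> \<otimes>\<^sub>v p\<close> is
  affine and any two of its values differ by some \<open>\<xi> \<otimes>\<^sub>v (p - q)\<close>, of
  rank at most one. On this slice rank-one convexity is ordinary convexity.\<close>

lemma convex_rank_one_line:
  assumes "rank_one_convex C"
  shows "convex {p. P + \<xi> \<otimes>\<^sub>v p \<in> C}"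
proof (rule convexI)
  fix p q and l m :: real
  assume *: "p \<in> {p. P + \<xi> \<otimes>\<^sub>v p \<in> C}" "q \<in> {p. P + \<xi> \<otimes>\<^sub>v p \<in> C}" "0 \<le> l" "0 \<le> m" "l + m = 1"
  have "(P + \<xi> \<otimes>\<^sub>v p) - (P + \<xi> \<otimes>\<^sub>v q) = \<xi> \<otimes>\<^sub>v (p - q)"
    by (simp add: tensor_def vec_eq_iff algebra_simps)
  then have "rank ((P + \<xi> \<otimes>\<^sub>v p) - (P + \<xi> \<otimes>\<^sub>v q)) \<le> 1"
    by (simp only: rank_tensor_le_1)
  then have "l *\<^sub>R (P + \<xi> \<otimes>\<^sub>v p) + (1 - l) *\<^sub>R (P + \<xi> \<otimes>\<^sub>v q) \<in> C"
    using assms * unfolding rank_one_convex_def by auto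
  moreover have "l *\<^sub>R (P + \<xi> \<otimes>\<^sub>v p) + (1 - l) *\<^sub>R (P + \<xi> \<otimes>\<^sub>v q) = P + \<xi> \<otimes>\<^sub>v (l *\<^sub>R p + (1 - l) *\<^sub>R q)"
    by (simp add: tensor_def vec_eq_iff algebra_simps)
  ultimately show "l *\<^sub>R p + m *\<^sub>R q \<in> {p. P + \<xi> \<otimes>\<^sub>v p \<in> C}"
    using \<open>l + m = 1\<close> by (metis add_diff_cancel_left' mem_Collect_eq)
qed

lemma continuous_on_tensor [continuous_intros]:
  "continuous_on S f \<Longrightarrow> continuous_on S (\<lambda>x. \<xi> \<otimes>\<^sub>v f x)"
  unfolding tensor_def by (intro continuous_intros)

lemma continuous_on_jacobian:
  fixes u :: "real^'n \<Rightarrow> real^'m"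
  assumes "Ck_on 1 S u"
  shows "continuous_on S (\<lambda>y. jacobian u (at y))"
proof -
  have "continuous_on S (partial i u)" for i using assms by simp
  then have "continuous_on S (\<lambda>y. \<chi> a i. partial i u y $ a)"
    by (intro continuous_intros)
  then show ?thesis by (simp add: jacobian_def matrix_def partial_def)
qed

section \<open>Essential suprema over shrinking balls and their limit\<close>

lemma esssup_mono_set:
  fixes f :: "'a::euclidean_space \<Rightarrow> ereal"
  assumes "U \<subseteq> V" "U \<in> sets lebesgue" "V \<in> sets lebesgue"
  shows "esssup (lebesgue_on U) f \<le> esssup (lebesgue_on V) f"
\<comment> \<open>By convention \<open>esssup\<close> of a non-measurable function is the top
  element, so the remaining case is trivial.\<close>
proof (cases "f \<in> borel_measurable (lebesgue_on V)")
  case True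
  then have "f \<in> borel_measurable (lebesgue_on U)"
    using assms measurable_restrict_mono by blast
  moreover have "AE y in lebesgue_on V. f y \<le> esssup (lebesgue_on V) f" by (rule esssup_AE)
  then have "AE y in lebesgue_on U. f y \<le> esssup (lebesgue_on V) f"
    using assms by (auto simp: AE_restrict_space_iff elim: eventually_mono)
  ultimately show ?thesis by (rule esssup_I)
qed (simp add: esssup_non_measurable)

lemma mono_tendsto_at_right:
  fixes G :: "real \<Rightarrow> 'a::{complete_linorder, linorder_topology}"
  assumes "\<And>r s. 0 < r \<Longrightarrow> r \<le> s \<Longrightarrow> G r \<le> G s"
  shows "(G \<longlongrightarrow> (INF r\<in>{0<..}. G r)) (at_right 0)"
proof (rule order_tendstoI)
  fix l assume "l < (INF r\<in>{0<..}. G r)"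
  then have "l < G r" if "0 < r" for r using that by (auto simp: less_INF_D)
  then show "\<forall>\<^sub>F r in at_right 0. l < G r" by (auto simp: eventually_at_filter)
next
  fix l assume "(INF r\<in>{0<..}. G r) < l"
  then obtain s where "0 < s" "G s < l" by (auto simp: INF_less_iff)
  then have "G r < l" if "0 < r" "r < s" for r
    using assms[of r s] that by (meson le_less_trans less_imp_le)
  then show "\<forall>\<^sub>F r in at_right 0. G r < l"
    using \<open>0 < s\<close> by (intro eventually_at_rightI[of 0 s]) auto
qed

section \<open>Lower bound for the essential suprema near an extremum of \<phi>\<close>

theorem corollary2:
  fixes \<Omega> \<Omega>' :: "(real^'n) set"
    and H :: "(real^'n) \<times> (real^'n^'m) \<Rightarrow> real"
    and u :: "real^'n \<Rightarrow> real^'m"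
    and c :: real
    and \<phi> :: "real^'n \<Rightarrow> real"
    and D\<phi> :: "real^'n \<Rightarrow> real^'n"
    and \<xi> :: "real^'m"
    and x :: "real^'n"
  assumes "open \<Omega>"
    and "continuous_on (\<Omega> \<times> UNIV) H"
    and "\<And>y P. y \<in> \<Omega> \<Longrightarrow> H (y, P) \<ge> 0"
    and "\<And>y t. y \<in> \<Omega> \<Longrightarrow> t \<ge> 0 \<Longrightarrow> rank_one_convex {P. H (y, P) \<le> t}"
    and "Ck_on 1 \<Omega> u"
    and "c \<ge> 0"
    and "\<And>y. y \<in> \<Omega> \<Longrightarrow> H (y, jacobian u (at y)) = c"
    and "compactly_contained \<Omega>' \<Omega>"
    and "\<phi> \<in> W1inf_0 \<Omega>'"
    and "Linf_weak_gradient \<Omega>' \<phi> D\<phi>"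
    and "x \<in> \<Omega>'"
    and "(\<forall>\<^sub>F y in nhds x. \<phi> y \<le> \<phi> x) \<or> (\<forall>\<^sub>F y in nhds x. \<phi> x \<le> \<phi> y)"
  shows "\<exists>L::ereal.
    ((\<lambda>\<rho>. esssup (lebesgue_on (ball x \<rho>))
             (\<lambda>y. ereal (H (y, jacobian u (at y) + \<xi> \<otimes>\<^sub>v D\<phi> y)))) \<longlongrightarrow> L) (at_right 0)
    \<and> esssup (lebesgue_on \<Omega>') (\<lambda>y. ereal (H (y, jacobian u (at y)))) \<le> L"
proof -
  note H_cont = assms(2) and H_nonneg = assms(3) and H_convex = assms(4)
  have sub: "\<Omega>' \<subseteq> \<Omega>" and open': "open \<Omega>'" and "compact (closure \<Omega>')"
    using assms(8) closure_subset by (auto simp: compactly_contained_def)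
  then have bdd': "bounded \<Omega>'" by (meson bounded_closure_image bounded_subset closure_subset compact_imp_bounded)
  have \<phi>: "\<phi> \<in> Linf \<Omega>'" "continuous_on \<Omega>' \<phi>"
    using assms(9) closure_subset by (auto simp: W1inf_0_def W1inf_def intro: continuous_on_subset)
  define f where "f y = H (y, jacobian u (at y) + \<xi> \<otimes>\<^sub>v D\<phi> y)" for y
  define G where "G \<rho> = esssup (lebesgue_on (ball x \<rho>)) (\<lambda>y. ereal (f y))" for \<rho>
  have Du: "continuous_on \<Omega> (\<lambda>y. jacobian u (at y))" by (rule continuous_on_jacobian) fact
  have lower: "ereal c \<le> G \<rho>" if \<rho>: "0 < \<rho>" for \<rho>
  proof (rule ccontr)
    assume "\<not> ereal c \<le> G \<rho>"
    then have "G \<rho> < ereal c" by simp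
    then obtain t where t: "G \<rho> < ereal t" "t < c" by (metis ereal_dense2 less_ereal.simps(1))
    \<comment> \<open>The gap between \<open>t\<close> and \<open>t'\<close> absorbs the error of
      freezing the base point at \<open>x\<close>; the gap between \<open>t'\<close> and
      \<open>c\<close> keeps 0 out of \<open>K\<close>.\<close>
    define t' where "t' = (t + c) / 2"
    have t': "t < t'" "t' < c" using t(2) by (auto simp: t'_def)
    \<comment> \<open>The given ball may leave \<Omega>', so the argument moves to a smaller one
      whose closure stays inside and is compact.\<close>
    obtain r where r: "0 < r" "cball x r \<subseteq> \<Omega>'" "r \<le> \<rho>"
    proof -
      obtain r where "0 < r" "cball x r \<subseteq> \<Omega>'" using open' assms(11) open_contains_cball by blast
      then show ?thesis using that[of "min r \<rho>"] \<rho> by (auto simp: subset_iff)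
    qed
    have AE_f: "AE y in lebesgue. y \<in> ball x r \<longrightarrow> f y < t"
    proof -
      have "AE y in lebesgue_on (ball x \<rho>). ereal (f y) \<le> G \<rho>"
        unfolding G_def by (rule esssup_AE)
      then have "AE y in lebesgue. y \<in> ball x \<rho> \<longrightarrow> ereal (f y) \<le> G \<rho>"
        by (simp add: AE_restrict_space_iff)
      then show ?thesis
      proof eventually_elim
        case (elim y)
        then show ?case using t(1) r(3) by (auto dest: le_less_trans)
      qed
    qed
    \<comment> \<open>Rank-one convexity is assumed for nonnegative levels. A single point with 0
      \<le> f(y0) < t shows that \<open>t\<close>, and hence \<open>t'\<close>, is such a
      level.\<close>
    obtain y0 where "y0 \<in> ball x r" "f y0 < t"
      using AE_lebesgue_open[OF AE_f, of "ball x r"] r(1) by auto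
    then have "0 \<le> t"
      using H_nonneg[of y0 "jacobian u (at y0) + \<xi> \<otimes>\<^sub>v D\<phi> y0"] r(2) sub by (force simp: f_def)
    obtain M where M: "AE y in lebesgue_on \<Omega>'. norm (D\<phi> y) \<le> M"
      using assms(10) by (auto simp: Linf_weak_gradient_def Linf_def)
    define h where "h = (\<lambda>(y, p). H (y, jacobian u (at y) + \<xi> \<otimes>\<^sub>v p))"
    have h_cont: "continuous_on (\<Omega> \<times> UNIV) h"
      unfolding h_def case_prod_unfold
      by (rule continuous_on_compose2[OF H_cont])
        (auto intro!: continuous_intros continuous_on_compose2[OF Du])
    define K where "K = {p. h (x, p) \<le> t'} \<inter> cball 0 M"
    have x: "x \<in> \<Omega>" using assms(11) sub by auto
    have "convex K"
    proof -
      have "{p. h (x, p) \<le> t'} = {p. jacobian u (at x) + \<xi> \<otimes>\<^sub>v p \<in> {P. H (x, P) \<le> t'}}"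
        by (simp add: h_def)
      moreover have "rank_one_convex {P. H (x, P) \<le> t'}"
        using \<open>0 \<le> t\<close> t' x by (intro H_convex) auto
      ultimately have "convex {p. h (x, p) \<le> t'}"
        by (simp only: convex_rank_one_line)
      then show ?thesis unfolding K_def by (intro convex_Int convex_cball)
    qed
    moreover have "closed K"
    proof -
      have "continuous_on UNIV (\<lambda>p. h (x, p))"
        by (rule continuous_on_compose2[OF h_cont]) (use x in \<open>auto intro!: continuous_intros\<close>)
      then show ?thesis unfolding K_def
        by (intro closed_Int closed_Collect_le closed_cball continuous_on_const)
    qed
    moreover have "0 \<notin> K"
    proof -
      have "\<xi> \<otimes>\<^sub>v (0::real^'n) = 0" by (simp add: tensor_def vec_eq_iff)
      then show ?thesis using assms(7)[OF x] t' by (simp add: K_def h_def)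
    qed
    ultimately obtain v b where v: "v \<noteq> 0" "0 < b" "\<And>p. p \<in> K \<Longrightarrow> b < v \<bullet> p"
      using separating_hyperplane_closed_0 by metis
    \<comment> \<open>Compactness in both variables makes the freezing error small uniformly over
      all gradients of norm at most \<open>M\<close>.\<close>
    have "uniformly_continuous_on (cball x r \<times> cball 0 M) h"
      using r(2) sub by (intro compact_uniformly_continuous continuous_on_subset[OF h_cont] compact_Times) auto
    then obtain d where d: "0 < d"
      "\<And>z w. z \<in> cball x r \<times> cball 0 M \<Longrightarrow> w \<in> cball x r \<times> cball 0 M \<Longrightarrow> dist w z < d \<Longrightarrow> dist (h w) (h z) < t' - t"
      unfolding uniformly_continuous_on_def using t' by (meson diff_gt_0_iff_gt)
    have "AE y in lebesgue_on \<Omega>'. y \<in> ball x r \<longrightarrow> f y < t"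
      using AE_f open' by (auto simp: AE_restrict_space_iff elim: eventually_mono)
    then have "AE y in lebesgue_on \<Omega>'. y \<in> ball x (min r d) \<longrightarrow> b / norm v \<le> (v /\<^sub>R norm v) \<bullet> D\<phi> y"
      using M
    proof eventually_elim
      case (elim y)
      show ?case
      proof
        assume y: "y \<in> ball x (min r d)"
        then have "f y < t" using elim by simp
        \<comment> \<open>Moving the base point from \<open>y\<close> to \<open>x\<close> costs less
          than t' - t, so the bound f(y) < t becomes \<open>h (x, D\<phi> y) < t'\<close>.\<close>
        moreover have "dist (h (x, D\<phi> y)) (h (y, D\<phi> y)) < t' - t"
          using y elim r(1) by (intro d(2)) (auto simp: dist_Pair_Pair)
        ultimately have "D\<phi> y \<in> K"
          using elim by (auto simp: K_def h_def f_def dist_real_def)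
        then show "b / norm v \<le> (v /\<^sub>R norm v) \<bullet> D\<phi> y"
          using v by (simp add: divide_right_mono less_imp_le inverse_eq_divide)
      qed
    qed
    \<comment> \<open>The separating vector, scaled to norm one, is a direction in which the
      gradient is at least b / |v| > 0 near \<open>x\<close>, which the extremum excludes.\<close>
    then show False
      using no_local_extremum_if_weak_gradient_directed[OF open' bdd' \<phi> assms(10), of "v /\<^sub>R norm v" "b / norm v" x "min r d"]
        v(1,2) r(1) d(1) assms(11,12) by simp
  qed
  have mono: "G r \<le> G s" if "r \<le> s" for r s
    unfolding G_def using that by (intro esssup_mono_set subset_ball) auto
  have "esssup (lebesgue_on \<Omega>') (\<lambda>y. ereal (H (y, jacobian u (at y)))) \<le> ereal c"
  proof (rule esssup_I)
    have eq: "ereal (H (y, jacobian u (at y))) = ereal c" if "y \<in> space (lebesgue_on \<Omega>')" for y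
      using that assms(7) sub by auto
    show "(\<lambda>y. ereal (H (y, jacobian u (at y)))) \<in> borel_measurable (lebesgue_on \<Omega>')"
      using measurable_cong[THEN iffD2, OF eq borel_measurable_const] .
    show "AE y in lebesgue_on \<Omega>'. ereal (H (y, jacobian u (at y))) \<le> ereal c"
      by (rule AE_I2) (simp only: eq order_refl)
  qed
  also have "\<dots> \<le> (INF \<rho>\<in>{0<..}. G \<rho>)" using lower by (auto intro: INF_greatest)
  finally show ?thesis
    using mono_tendsto_at_right[of G, OF mono] unfolding G_def f_def by blast
qed

end
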